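(* Let $\alpha\in(0,1)$ and, for every $i\in\mathbb N$, let $\tau_i\in(0,1]$ and $\lambda_i\in[0,\tau_i)$ be $\mathcal G_{i-1}$-measurable. Allow the parameters $\gamma_i$ ($i\in\mathbb N$) and $g_{j,i}$ ($j\in\mathbb N$, $i>j$) of an ADDIS-Graph to be random variables that are measurable with respect to $\mathcal G_{i-1}$. Then any online procedure $(\tilde\alpha_i)_{i\in\mathbb N}$ satisfying $$\sum_{j=1}^{i}\frac{\tilde\alpha_j}{\tau_j-\lambda_j}\left(\mathbf 1\{P_j\le\tau_j\}-\mathbf 1\{P_j\le\lambda_j\}\right)\le\alpha\qquad\text{for all } i\in\mathbb N$$ can be written as an ADDIS-Graph. That is, there exist non-negative $\gamma_i$ ($i\in\mathbb N$) and $g_{j,i}$ ($j\in\mathbb N$, $i>j$), with $\gamma_i$ and $g_{j,i}$ measurable with respect to $\mathcal G_{i-1}$, $\sum_{i\in\mathbb N}\gamma_i\le1$ and $\sum_{i=j+1}^\infty g_{j,i}\le1$ for all $j\in\mathbb N$, such that $$\tilde\alpha_i=(\tau_i-\lambda_i)\left(\alpha\gamma_i+\sum_{j=1}^{i-1}g_{j,i}\,(C_j-S_j+1)\,\frac{\tilde\alpha_j}{\tau_j-\lambda_j}\right)\qquad\text{for all } i\in\mathbb N,$$ where $S_j=\mathbf 1\{P_j\le\tau_j\}$ and $C_j=\mathbf 1\{P_j\le\lambda_j\}$.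
   Context: $(H_i)_{i\in\mathbb N}$ is a sequence of null hypotheses with p-values $(P_i)_{i\in\mathbb N}$ in $[0,1]$, and $\mathcal G_{i-1}=\sigma(P_1,\dots,P_{i-1})$. An online procedure is a sequence of non-negative random variables $(\tilde\alpha_i)_{i\in\mathbb N}$ (individual significance levels; $H_i$ is rejected if $P_i\le\tilde\alpha_i$) such that $\tilde\alpha_i$ is $\mathcal G_{i-1}$-measurable for every $i$. An ADDIS-Graph with parameters $(\gamma_i)_{i\in\mathbb N}$, $(g_{j,i})_{i=j+1}^\infty$ ($j\in\mathbb N$), $(\tau_i)_{i\in\mathbb N}$ and $(\lambda_i)_{i\in\mathbb N}$, where $(\gamma_i)_{i\in\mathbb N}$ and each $(g_{j,i})_{i=j+1}^\infty$ are non-negative and sum to at most one, is the procedure testing each $H_i$ at the level $\alpha_i$ given recursively by $\alpha_i=(\tau_i-\lambda_i)\big(\alpha\gamma_i+\sum_{j=1}^{i-1}g_{j,i}(C_j-S_j+1)\frac{\alpha_j}{\tau_j-\lambda_j}\big)$.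
   Formalization: The formal theorem also assumes that, for every i and every possible past P_1,…,P_{i-1}, some outcome with that past has λ_i < P_i ≤ τ_i; without it the claim fails (e.g. P_i=0, τ_i=1, λ_i=0 always, level 2). (In)equalities hold pointwise. *)

theory Defs
  imports "HOL-Probability.Probability"
begin

text \<open>
  Hypotheses are indexed by \<open>nat\<close>, starting from 0, so the p-values preceding \<open>P i\<close> are
  \<open>P 0, \<dots>, P (i - 1)\<close>, and \<open>past_algebra M P i\<close> is the sigma-algebra they generate. It is the
  trivial one for \<open>i = 0\<close>; a supremum of \<open>vimage_algebra\<close>s would have empty space there.
\<close>

definition past_algebra :: "'a measure \<Rightarrow> (nat \<Rightarrow> 'a \<Rightarrow> real) \<Rightarrow> nat \<Rightarrow> 'a measure" where
  "past_algebra M P i =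
     sigma (space M) {P j -` A \<inter> space M |j A. j < i \<and> A \<in> sets borel}"

definition p_values :: "'a measure \<Rightarrow> (nat \<Rightarrow> 'a \<Rightarrow> real) \<Rightarrow> bool" where
  "p_values M P \<longleftrightarrow>
     (\<forall>i. P i \<in> borel_measurable M) \<and> (\<forall>i. \<forall>\<omega>\<in>space M. 0 \<le> P i \<omega> \<and> P i \<omega> \<le> 1)"

definition online_procedure ::
    "'a measure \<Rightarrow> (nat \<Rightarrow> 'a \<Rightarrow> real) \<Rightarrow> (nat \<Rightarrow> 'a \<Rightarrow> real) \<Rightarrow> bool" where
  "online_procedure M P a \<longleftrightarrow>
     (\<forall>i. a i \<in> borel_measurable (past_algebra M P i)) \<and> (\<forall>i. \<forall>\<omega>\<in>space M. 0 \<le> a i \<omega>)"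

text \<open>
  A testing procedure is a rule for arbitrary p-values, so a constraint on it is meant for all
  p-values that can be fed into it. On a fixed sample space this has to be said: whatever the
  first \<open>i\<close> p-values are, they must not rule out \<open>lam i < P i \<le> \<tau> i\<close>. Otherwise a constraint
  that involves \<open>a i\<close> only through \<open>a i * (S i - C i)\<close> puts no bound on \<open>a i\<close> at all.
  Nothing is required of the probabilities of these events, and by \<open>interval_possibleI\<close> the
  condition holds for every choice of \<open>\<tau>\<close> and \<open>lam\<close> if no combination of p-values in the unit
  interval is excluded, as on the canonical space of sequences.
\<close>

definition interval_possible ::
    "'a measure \<Rightarrow> (nat \<Rightarrow> 'a \<Rightarrow> real) \<Rightarrow> (nat \<Rightarrow> 'a \<Rightarrow> real) \<Rightarrow> (nat \<Rightarrow> 'a \<Rightarrow> real) \<Rightarrow> bool" where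
  "interval_possible M P \<tau> lam \<longleftrightarrow>
     (\<forall>i. \<forall>\<omega>\<in>space M. \<exists>\<omega>'\<in>space M.
        (\<forall>j<i. P j \<omega>' = P j \<omega>) \<and> lam i \<omega> < P i \<omega>' \<and> P i \<omega>' \<le> \<tau> i \<omega>)"

lemma interval_possibleI:
  assumes P: "p_values M P"
    and attained: "\<And>n p. (\<And>j. j \<le> n \<Longrightarrow> 0 \<le> p j \<and> p j \<le> 1) \<Longrightarrow>
      \<exists>\<omega>\<in>space M. \<forall>j\<le>n. P j \<omega> = p j"
    and bounds: "\<And>i \<omega>. \<omega> \<in> space M \<Longrightarrow> 0 < \<tau> i \<omega> \<and> \<tau> i \<omega> \<le> 1 \<and> lam i \<omega> < \<tau> i \<omega>"
  shows "interval_possible M P \<tau> lam"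
  unfolding interval_possible_def
proof (intro allI ballI)
  fix i \<omega> assume \<omega>: "\<omega> \<in> space M"
  let ?p = "\<lambda>j. if j < i then P j \<omega> else \<tau> i \<omega>"
  have "\<exists>\<omega>'\<in>space M. \<forall>j\<le>i. P j \<omega>' = ?p j"
    by (rule attained) (use P \<omega> bounds[OF \<omega>, of i] in \<open>auto simp: p_values_def\<close>)
  then obtain \<omega>' where "\<omega>' \<in> space M" and eq: "\<And>j. j \<le> i \<Longrightarrow> P j \<omega>' = ?p j"
    by blast
  moreover have "\<forall>j<i. P j \<omega>' = P j \<omega>" "P i \<omega>' = \<tau> i \<omega>"
    using eq by auto
  ultimately show "\<exists>\<omega>'\<in>space M.
      (\<forall>j<i. P j \<omega>' = P j \<omega>) \<and> lam i \<omega> < P i \<omega>' \<and> P i \<omega>' \<le> \<tau> i \<omega>"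
    using bounds[OF \<omega>] by (intro bexI[of _ \<omega>']) auto
qed

definition S_ind :: "(nat \<Rightarrow> 'a \<Rightarrow> real) \<Rightarrow> (nat \<Rightarrow> 'a \<Rightarrow> real) \<Rightarrow> nat \<Rightarrow> 'a \<Rightarrow> real" where
  "S_ind P \<tau> j \<omega> = of_bool (P j \<omega> \<le> \<tau> j \<omega>)"

definition C_ind :: "(nat \<Rightarrow> 'a \<Rightarrow> real) \<Rightarrow> (nat \<Rightarrow> 'a \<Rightarrow> real) \<Rightarrow> nat \<Rightarrow> 'a \<Rightarrow> real" where
  "C_ind P lam j \<omega> = of_bool (P j \<omega> \<le> lam j \<omega>)"

text \<open>Only the values \<open>g j i\<close> with \<open>j < i\<close> are used; the others are unconstrained.\<close>

definition ADDIS_params ::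
    "'a measure \<Rightarrow> (nat \<Rightarrow> 'a \<Rightarrow> real) \<Rightarrow> (nat \<Rightarrow> 'a \<Rightarrow> real) \<Rightarrow> (nat \<Rightarrow> nat \<Rightarrow> 'a \<Rightarrow> real) \<Rightarrow> bool"
where
  "ADDIS_params M P \<gamma> g \<longleftrightarrow>
     (\<forall>i. \<gamma> i \<in> borel_measurable (past_algebra M P i)) \<and>
     (\<forall>j i. j < i \<longrightarrow> g j i \<in> borel_measurable (past_algebra M P i)) \<and>
     (\<forall>\<omega>\<in>space M.
        (\<forall>i. 0 \<le> \<gamma> i \<omega>) \<and>
        (\<forall>j i. j < i \<longrightarrow> 0 \<le> g j i \<omega>) \<and>
        summable (\<lambda>i. \<gamma> i \<omega>) \<and> (\<Sum>i. \<gamma> i \<omega>) \<le> 1 \<and>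
        (\<forall>j. summable (\<lambda>k. g j (Suc j + k) \<omega>) \<and> (\<Sum>k. g j (Suc j + k) \<omega>) \<le> 1))"

definition ADDIS_Graph ::
    "'a measure \<Rightarrow> (nat \<Rightarrow> 'a \<Rightarrow> real) \<Rightarrow> real \<Rightarrow> (nat \<Rightarrow> 'a \<Rightarrow> real) \<Rightarrow> (nat \<Rightarrow> nat \<Rightarrow> 'a \<Rightarrow> real) \<Rightarrow>
     (nat \<Rightarrow> 'a \<Rightarrow> real) \<Rightarrow> (nat \<Rightarrow> 'a \<Rightarrow> real) \<Rightarrow> (nat \<Rightarrow> 'a \<Rightarrow> real) \<Rightarrow> bool"
where
  "ADDIS_Graph M P \<alpha> \<gamma> g \<tau> lam a \<longleftrightarrow>
     (\<forall>i. \<forall>\<omega>\<in>space M.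
        a i \<omega> = (\<tau> i \<omega> - lam i \<omega>) *
          (\<alpha> * \<gamma> i \<omega> +
           (\<Sum>j<i. g j i \<omega> * (C_ind P lam j \<omega> - S_ind P \<tau> j \<omega> + 1) *
                   (a j \<omega> / (\<tau> j \<omega> - lam j \<omega>)))))"

end

(* Put x_j = a_j / (tau_j - lam_j) and let v_j = C_j - S_j + 1, a value in {0, 1}. Since a_i, tau_i
   and lam_i only depend on the past, the constraint at index i may be used in a world with the same
   past in which lam_i < P_i <= tau_i; hence the demands x_0, x_1, ... satisfy
     x_0 + ... + x_i <= alpha + v_0 x_0 + ... + v_(i-1) x_(i-1)
   everywhere. So demand i can be served from the initial supply alpha and the returned supplies
   v_j x_j with j < i, first in, first out: lay out demands and supplies as consecutive intervals on
   the half-line; the amount that demand i draws from a supply is the length of the intersection of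
   their intervals, and gamma_i and g_(j,i) are these lengths relative to the size of the supply. *)

theory Submission
  imports Defs
begin

text \<open>The length of the intersection of \<open>[p, q]\<close> and \<open>[r, s]\<close>, in a form that telescopes over
  consecutive intervals on either side.\<close>

definition overlap :: "real \<Rightarrow> real \<Rightarrow> real \<Rightarrow> real \<Rightarrow> real" where
  "overlap p q r s = (min q s - min q r) - (min p s - min p r)"

lemma overlap_nonneg: "p \<le> q \<Longrightarrow> r \<le> s \<Longrightarrow> 0 \<le> overlap p q r s"
  unfolding overlap_def by linarith

lemma overlap_empty [simp]: "overlap p q r r = 0"
  by (simp add: overlap_def)

lemma sum_overlap_left:
  "(\<Sum>i<n. overlap (B i) (B (Suc i)) r s) = overlap (B 0) (B n) r s"
  by (induction n) (auto simp: overlap_def)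

lemma sum_overlap_right:
  "(\<Sum>j<n. overlap p q (T j) (T (Suc j))) = overlap p q (T 0) (T n)"
  by (induction n) (auto simp: overlap_def)

text \<open>Consecutive intervals with endpoints \<open>B\<close> cut non-overlapping pieces out of
  \<open>[r, s]\<close>, so the pieces add up to at most \<open>d\<close>. The offset
  \<open>m\<close> allows a sum over demands to start late, as it must for a supply that only later
  demands may use.\<close>

lemma overlap_proportion_sums:
  fixes B :: "nat \<Rightarrow> real"
  assumes B: "mono B" and "r \<le> s" "d = s - r"
  shows "summable (\<lambda>k. overlap (B (m + k)) (B (Suc (m + k))) r s / d)"
    and "(\<Sum>k. overlap (B (m + k)) (B (Suc (m + k))) r s / d) \<le> 1"
proof -
  let ?f = "\<lambda>k. overlap (B (m + k)) (B (Suc (m + k))) r s / d"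
  have nonneg: "0 \<le> ?f k" for k
    using assms monoD[OF B, of "m + k" "Suc (m + k)"]
    by (auto intro!: divide_nonneg_nonneg overlap_nonneg)
  have bound: "sum ?f {..<n} \<le> 1" for n
  proof -
    have "sum ?f {..<n} = overlap (B m) (B (m + n)) r s / d"
      using sum_overlap_left[of "\<lambda>k. B (m + k)" r s n] by (simp flip: sum_divide_distrib)
    moreover have "overlap (B m) (B (m + n)) r s \<le> d"
      using assms unfolding overlap_def by linarith
    \<comment> \<open>An empty supply, \<open>d = 0\<close>, is covered as well: division by zero
      gives 0.\<close>
    ultimately show ?thesis
      using assms by (auto simp: divide_le_eq_1)
  qed
  show summable: "summable ?f"
    by (rule summableI_nonneg_bounded[OF nonneg bound])
  show "suminf ?f \<le> 1"
    by (rule suminf_le_const[OF summable bound])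
qed

text \<open>Left endpoint of interval \<open>i\<close> when intervals of lengths \<open>x 0\<close>,
  \<open>x 1\<close>, ... are laid end to end from 0.\<close>

definition position :: "(nat \<Rightarrow> real) \<Rightarrow> nat \<Rightarrow> real" where
  "position x i = (\<Sum>k<i. x k)"

definition initial_share :: "real \<Rightarrow> (nat \<Rightarrow> real) \<Rightarrow> nat \<Rightarrow> real" where
  "initial_share \<alpha> x i = overlap (position x i) (position x (Suc i)) 0 \<alpha> / \<alpha>"

text \<open>The returned supplies are shifted by \<alpha> because the initial supply occupies
  \<open>[0, \<alpha>]\<close>.\<close>

definition share :: "real \<Rightarrow> (nat \<Rightarrow> real) \<Rightarrow> (nat \<Rightarrow> real) \<Rightarrow> nat \<Rightarrow> nat \<Rightarrow> real" where
  "share \<alpha> x y j i =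
     overlap (position x i) (position x (Suc i)) (\<alpha> + position y j) (\<alpha> + position y (Suc j)) / y j"

lemma position_Suc: "position x (Suc i) = position x i + x i"
  by (simp add: position_def)

lemma mono_position: "(\<And>k. 0 \<le> x k) \<Longrightarrow> mono (position x)"
  by (simp add: mono_iff_le_Suc position_Suc)

lemma position_nonneg: "(\<And>k. 0 \<le> x k) \<Longrightarrow> 0 \<le> position x i"
  by (simp add: position_def sum_nonneg)

lemma initial_share_nonneg:
  assumes "0 < \<alpha>" "\<And>k. 0 \<le> x k"
  shows "0 \<le> initial_share \<alpha> x i"
  using assms by (auto simp: initial_share_def position_Suc
      intro!: divide_nonneg_nonneg overlap_nonneg)

lemma share_nonneg:
  assumes "\<And>k. 0 \<le> x k" "\<And>k. 0 \<le> y k"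
  shows "0 \<le> share \<alpha> x y j i"
  using assms by (auto simp: share_def position_Suc intro!: divide_nonneg_nonneg overlap_nonneg)

lemma initial_share_sums:
  assumes "0 < \<alpha>" "\<And>k. 0 \<le> x k"
  shows "summable (initial_share \<alpha> x)" "suminf (initial_share \<alpha> x) \<le> 1"
  using overlap_proportion_sums[OF mono_position[of x], of 0 \<alpha> \<alpha> 0] assms
  by (simp_all add: initial_share_def[abs_def])

lemma share_sums:
  assumes "\<And>k. 0 \<le> x k" "\<And>k. 0 \<le> y k"
  shows "summable (\<lambda>k. share \<alpha> x y j (m + k))" "(\<Sum>k. share \<alpha> x y j (m + k)) \<le> 1"
proof -
  have "mono (position x)"
    using assms(1) by (rule mono_position)
  moreover have "\<alpha> + position y j \<le> \<alpha> + position y (Suc j)"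
    using assms(2) by (simp add: position_Suc)
  moreover have "y j = (\<alpha> + position y (Suc j)) - (\<alpha> + position y j)"
    by (simp add: position_Suc)
  ultimately show "summable (\<lambda>k. share \<alpha> x y j (m + k))" "(\<Sum>k. share \<alpha> x y j (m + k)) \<le> 1"
    unfolding share_def by (rule overlap_proportion_sums)+
qed

text \<open>By \<open>le\<close>, demand interval \<open>i\<close> lies inside
  \<open>[0, \<alpha> + position y i]\<close>, which is tiled by the initial supply and the first
  \<open>i\<close> returned supplies. Its overlaps with the tiles therefore add up to its whole
  length.\<close>

lemma demand_eq_shares:
  assumes "0 < \<alpha>" and x: "\<And>k. 0 \<le> x k" and y: "\<And>k. 0 \<le> y k"
    and le: "position x (Suc i) \<le> \<alpha> + position y i"
  shows "x i = \<alpha> * initial_share \<alpha> x i + (\<Sum>j<i. share \<alpha> x y j i * y j)"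
proof -
  let ?o = "overlap (position x i) (position x (Suc i))"
  \<comment> \<open>If \<open>y j = 0\<close>, the supply interval is a point and both sides
    vanish.\<close>
  have "share \<alpha> x y j i * y j = ?o (\<alpha> + position y j) (\<alpha> + position y (Suc j))" for j
    by (cases "y j = 0") (simp_all add: share_def position_Suc)
  then have "(\<Sum>j<i. share \<alpha> x y j i * y j) = ?o (\<alpha> + position y 0) (\<alpha> + position y i)"
    using sum_overlap_right[of "position x i" "position x (Suc i)" "\<lambda>j. \<alpha> + position y j" i] by simp
  moreover have "position y 0 = 0"
    by (simp add: position_def)
  moreover have "\<alpha> * initial_share \<alpha> x i = ?o 0 \<alpha>"
    using \<open>0 < \<alpha>\<close> by (simp add: initial_share_def)
  ultimately show ?thesis
    using le x[of i] position_nonneg[of x i, OF x] position_nonneg[of y i, OF y] \<open>0 < \<alpha>\<close>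
    unfolding overlap_def position_Suc by linarith
qed

lemma space_past_algebra [simp]: "space (past_algebra M P i) = space M"
  unfolding past_algebra_def by (rule space_measure_of) auto

lemma sets_past_algebra:
  "sets (past_algebra M P i) =
     sigma_sets (space M) {P j -` A \<inter> space M |j A. j < i \<and> A \<in> sets borel}"
  unfolding past_algebra_def by (rule sets_measure_of) auto

lemma measurable_past_algebra_mono:
  assumes "f \<in> borel_measurable (past_algebra M P i)" "i \<le> k"
  shows "f \<in> borel_measurable (past_algebra M P k)"
proof -
  have "sets (past_algebra M P i) \<subseteq> sets (past_algebra M P k)"
    unfolding sets_past_algebra using \<open>i \<le> k\<close> by (intro sigma_sets_mono') fastforce
  then show ?thesis
    using assms(1) by (auto simp: measurable_def)
qed

lemma measurable_past_algebra_coordinate: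
  assumes "j < i"
  shows "P j \<in> borel_measurable (past_algebra M P i)"
  using assms by (auto simp: measurable_def sets_past_algebra)

text \<open>The sets that do not separate two points with the same past form a sigma-algebra
  containing the generators, so each level set of \<open>f\<close> contains both points or
  neither.\<close>

lemma measurable_past_algebra_eq:
  fixes f :: "'a \<Rightarrow> real"
  assumes f: "f \<in> borel_measurable (past_algebra M P i)"
    and \<omega>: "\<omega> \<in> space M" "\<omega>' \<in> space M" and eq: "\<And>j. j < i \<Longrightarrow> P j \<omega>' = P j \<omega>"
  shows "f \<omega>' = f \<omega>"
proof -
  have "\<omega> \<in> A \<longleftrightarrow> \<omega>' \<in> A" if "A \<in> sets (past_algebra M P i)" for A
    using that unfolding sets_past_algebra
    by (induction rule: sigma_sets.induct) (use \<omega> eq in auto)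
  moreover have "f -` {f \<omega>} \<inter> space M \<in> sets (past_algebra M P i)"
    using measurable_sets[OF f, of "{f \<omega>}"] by simp
  ultimately show ?thesis
    using \<omega> by blast
qed

theorem proposition3p2:
  fixes M :: "'a measure"
    and P \<tau> lam a :: "nat \<Rightarrow> 'a \<Rightarrow> real"
    and \<alpha> :: real
  assumes "prob_space M"
    and "p_values M P"
    and "0 < \<alpha>" and "\<alpha> < 1"
    and "\<And>i. \<tau> i \<in> borel_measurable (past_algebra M P i)"
    and "\<And>i. lam i \<in> borel_measurable (past_algebra M P i)"
    and "\<And>i \<omega>. \<omega> \<in> space M \<Longrightarrow> 0 < \<tau> i \<omega> \<and> \<tau> i \<omega> \<le> 1"
    and "\<And>i \<omega>. \<omega> \<in> space M \<Longrightarrow> 0 \<le> lam i \<omega> \<and> lam i \<omega> < \<tau> i \<omega>"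
    and "interval_possible M P \<tau> lam"
    and "online_procedure M P a"
    and "\<And>i \<omega>. \<omega> \<in> space M \<Longrightarrow>
           (\<Sum>j\<le>i. a j \<omega> / (\<tau> j \<omega> - lam j \<omega>) * (S_ind P \<tau> j \<omega> - C_ind P lam j \<omega>)) \<le> \<alpha>"
  shows "\<exists>\<gamma> g. ADDIS_params M P \<gamma> g \<and> ADDIS_Graph M P \<alpha> \<gamma> g \<tau> lam a"
proof -
  note \<tau> = assms(5) and lam = assms(6) and lam_less = assms(8) and constraint = assms(11)
  have a: "a i \<in> borel_measurable (past_algebra M P i)" for i
    using assms(10) by (simp add: online_procedure_def)
  define x where "x \<omega> j = a j \<omega> / (\<tau> j \<omega> - lam j \<omega>)" for \<omega> j
  define v where "v \<omega> j = C_ind P lam j \<omega> - S_ind P \<tau> j \<omega> + 1" for \<omega> j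
  define y where "y \<omega> j = v \<omega> j * x \<omega> j" for \<omega> j

  have x_meas: "(\<lambda>\<omega>. x \<omega> j) \<in> borel_measurable (past_algebra M P i)" if "j \<le> i" for j i
    unfolding x_def using measurable_past_algebra_mono[OF a that]
      measurable_past_algebra_mono[OF \<tau> that] measurable_past_algebra_mono[OF lam that]
    by measurable
  \<comment> \<open>Unlike \<open>x\<close>, \<open>v\<close> at index \<open>j\<close> looks at
    \<open>P j\<close> itself, hence the strict inequality.\<close>
  have v_meas: "(\<lambda>\<omega>. v \<omega> j) \<in> borel_measurable (past_algebra M P i)" if "j < i" for j i
    unfolding v_def C_ind_def S_ind_def
    using measurable_past_algebra_mono[OF \<tau> less_imp_le[OF that]]
      measurable_past_algebra_mono[OF lam less_imp_le[OF that]]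
      measurable_past_algebra_coordinate[OF that, of P M]
    by measurable
  have y_meas: "(\<lambda>\<omega>. y \<omega> j) \<in> borel_measurable (past_algebra M P i)" if "j < i" for j i
    unfolding y_def using x_meas[of j i] v_meas[OF that] that by simp
  \<comment> \<open>The bound reaches \<open>Suc i\<close> because the right end of demand interval
    \<open>i\<close> involves only \<open>x\<close> up to index \<open>i\<close>, which is already
    known from the past.\<close>
  have pos_x_meas: "(\<lambda>\<omega>. position (x \<omega>) j) \<in> borel_measurable (past_algebra M P i)"
    if "j \<le> Suc i" for j i
    unfolding position_def using that by (intro borel_measurable_sum x_meas) auto
  have pos_y_meas: "(\<lambda>\<omega>. position (y \<omega>) j) \<in> borel_measurable (past_algebra M P i)"
    if "j \<le> i" for j i
    unfolding position_def using that by (intro borel_measurable_sum y_meas) auto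

  have x_nonneg: "0 \<le> x \<omega> j" if "\<omega> \<in> space M" for \<omega> j
    using assms(10) lam_less[OF that, of j] that
    by (auto simp: x_def online_procedure_def intro!: divide_nonneg_nonneg)
  have y_nonneg: "0 \<le> y \<omega> j" if "\<omega> \<in> space M" for \<omega> j
    using x_nonneg[OF that, of j] by (auto simp: y_def v_def C_ind_def S_ind_def)

  have le: "position (x \<omega>) (Suc i) \<le> \<alpha> + position (y \<omega>) i" if \<omega>: "\<omega> \<in> space M" for \<omega> i
  proof -
    obtain \<omega>' where \<omega>': "\<omega>' \<in> space M" and past: "\<And>j. j < i \<Longrightarrow> P j \<omega>' = P j \<omega>"
      and between: "lam i \<omega> < P i \<omega>'" "P i \<omega>' \<le> \<tau> i \<omega>"
      using assms(9) \<omega> unfolding interval_possible_def by meson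
    have same: "f \<omega>' = f \<omega>" if "f \<in> borel_measurable (past_algebra M P i)" for f :: "'a \<Rightarrow> real"
      using measurable_past_algebra_eq[OF that \<omega> \<omega>'] past by blast
    \<comment> \<open>\<open>between\<close> compares \<open>P i \<omega>'\<close> with the
      thresholds at \<open>\<omega>\<close>; by \<open>same\<close> these are also the thresholds at
      \<open>\<omega>'\<close>. The term \<open>x \<omega>' i\<close> thus enters the constraint
      with full weight.\<close>
    have "v \<omega>' i = 0"
      using between same[OF \<tau>] same[OF lam] by (simp add: v_def C_ind_def S_ind_def)
    moreover have "(\<Sum>j\<le>i. x \<omega>' j * (1 - v \<omega>' j)) \<le> \<alpha>"
      using constraint[OF \<omega>', of i] by (simp add: x_def v_def)
    ultimately have "x \<omega>' i + (\<Sum>j<i. x \<omega>' j - y \<omega>' j) \<le> \<alpha>"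
      by (simp add: y_def algebra_simps flip: lessThan_Suc_atMost)
    moreover have "x \<omega>' i = x \<omega> i"
      by (rule same[OF x_meas]) simp
    moreover have "(\<Sum>j<i. x \<omega>' j - y \<omega>' j) = (\<Sum>j<i. x \<omega> j - y \<omega> j)"
      by (intro sum.cong arg_cong2[of _ _ _ _ minus] refl same[OF x_meas] same[OF y_meas]) simp_all
    ultimately show ?thesis
      by (simp add: position_def sum_subtractf)
  qed

  let ?\<gamma> = "\<lambda>i \<omega>. initial_share \<alpha> (x \<omega>) i" and ?g = "\<lambda>j i \<omega>. share \<alpha> (x \<omega>) (y \<omega>) j i"
  have "?\<gamma> i \<in> borel_measurable (past_algebra M P i)" for i
    unfolding initial_share_def overlap_def
    using pos_x_meas[of i i] pos_x_meas[of "Suc i" i] by simp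
  moreover have "?g j i \<in> borel_measurable (past_algebra M P i)" if "j < i" for j i
    unfolding share_def overlap_def
    using that pos_x_meas[of i i] pos_x_meas[of "Suc i" i] pos_y_meas[of j i]
      pos_y_meas[of "Suc j" i] y_meas[of j i] by simp
  ultimately have "ADDIS_params M P ?\<gamma> ?g"
    unfolding ADDIS_params_def
    \<comment> \<open>Keeping \<open>Suc j + k\<close> unsimplified lets \<open>share_sums\<close>
      apply with \<open>m = Suc j\<close>.\<close>
    using x_nonneg y_nonneg assms(3)
    by (auto intro!: initial_share_nonneg share_nonneg initial_share_sums share_sums
        simp del: add_Suc)
  moreover have "ADDIS_Graph M P \<alpha> ?\<gamma> ?g \<tau> lam a"
    unfolding ADDIS_Graph_def
  proof (intro allI ballI)
    fix i \<omega> assume \<omega>: "\<omega> \<in> space M"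
    have "a i \<omega> = (\<tau> i \<omega> - lam i \<omega>) * x \<omega> i"
      using lam_less[OF \<omega>, of i] by (simp add: x_def)
    also have "x \<omega> i = \<alpha> * ?\<gamma> i \<omega> + (\<Sum>j<i. ?g j i \<omega> * y \<omega> j)"
      by (rule demand_eq_shares[OF assms(3) x_nonneg[OF \<omega>] y_nonneg[OF \<omega>] le[OF \<omega>]])
    \<comment> \<open>The factor \<open>C - S + 1\<close> of the graph is the \<open>v\<close>
      inside \<open>y\<close>, so the two sums agree term by term.\<close>
    finally show "a i \<omega> = (\<tau> i \<omega> - lam i \<omega>) *
        (\<alpha> * ?\<gamma> i \<omega> + (\<Sum>j<i. ?g j i \<omega> * (C_ind P lam j \<omega> - S_ind P \<tau> j \<omega> + 1) *
           (a j \<omega> / (\<tau> j \<omega> - lam j \<omega>))))"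
      by (simp add: y_def v_def x_def mult.assoc)
  qed
  ultimately show ?thesis
    by blast
qed

end
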